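(* Fix $n>k\ge0$. The number $b(n,k)$ of boolean intervals of rank $k$ in the middle order $\mathcal{P}_n$ is $$b(n,k)=\sum_{i=0}^{n}\binom{i}{k}\,c(n,n-i),$$ where $c(n,j)$ is the number of permutations of size $n$ having exactly $j$ cycles (signless Stirling number of the first kind).
   Context: For $w\in S_n$ (one-line notation), its inversion sequence is $I(w)=(x_1,\ldots,x_n)$ with $x_i=\#\{j<i : w^{-1}(j)>w^{-1}(i)\}$. The middle order $\mathcal{P}_n$ is the poset on $S_n$ with $v\le w$ iff $I(v)\le I(w)$ coordinate-wise; it is graded with rank of $w$ equal to the sum of entries of $I(w)$, and the rank of $[v,w]$ is $r(w)-r(v)$. An interval is boolean if it is isomorphic to a boolean algebra. *)

theory Defs
  imports "HOL-Combinatorics.Combinatorics"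
begin

definition Sym :: "nat \<Rightarrow> (nat \<Rightarrow> nat) set" where
  "Sym n = {w. w permutes {1..n}}"

(* In one-line notation w(1) ... w(n), the inverse inv w i is the position of the value i. *)
definition inv_entry :: "(nat \<Rightarrow> nat) \<Rightarrow> nat \<Rightarrow> nat" where
  "inv_entry w i = card {j. 1 \<le> j \<and> j < i \<and> inv w j > inv w i}"

definition inv_seq :: "nat \<Rightarrow> (nat \<Rightarrow> nat) \<Rightarrow> nat list" where
  "inv_seq n w = map (inv_entry w) [1..<Suc n]"

definition middle_le :: "nat \<Rightarrow> (nat \<Rightarrow> nat) \<Rightarrow> (nat \<Rightarrow> nat) \<Rightarrow> bool" where
  "middle_le n v w \<longleftrightarrow> list_all2 (\<le>) (inv_seq n v) (inv_seq n w)"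

definition middle_rank :: "nat \<Rightarrow> (nat \<Rightarrow> nat) \<Rightarrow> nat" where
  "middle_rank n w = sum_list (inv_seq n w)"

definition middle_interval :: "nat \<Rightarrow> (nat \<Rightarrow> nat) \<Rightarrow> (nat \<Rightarrow> nat) \<Rightarrow> (nat \<Rightarrow> nat) set" where
  "middle_interval n v w = {u \<in> Sym n. middle_le n v u \<and> middle_le n u w}"

(* P with the order le is isomorphic to the boolean algebra of all subsets of a finite set,
   taken without loss of generality to be {1..m}; m = 0 gives the one-element algebra. *)
definition boolean_poset :: "('a \<Rightarrow> 'a \<Rightarrow> bool) \<Rightarrow> 'a set \<Rightarrow> bool" where
  "boolean_poset le P \<longleftrightarrow>
     (\<exists>(m::nat) f. bij_betw f P (Pow {1..m}) \<and>
        (\<forall>x\<in>P. \<forall>y\<in>P. le x y \<longleftrightarrow> f x \<subseteq> f y))"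

(* Intervals are counted as subsets of Sym n. The truncated subtraction is harmless:
   the rank is monotone and v lies below w. *)
definition boolean_intervals :: "nat \<Rightarrow> nat \<Rightarrow> (nat \<Rightarrow> nat) set set" where
  "boolean_intervals n k =
     {middle_interval n v w | v w.
        v \<in> Sym n \<and> w \<in> Sym n \<and> middle_le n v w \<and>
        boolean_poset (middle_le n) (middle_interval n v w) \<and>
        middle_rank n w - middle_rank n v = k}"

(* Fixed points contribute singleton orbits, so they count as cycles. *)
definition num_cycles :: "nat \<Rightarrow> (nat \<Rightarrow> nat) \<Rightarrow> nat" where
  "num_cycles n p = card (orbit p ` {1..n})"

definition cycle_count :: "nat \<Rightarrow> nat \<Rightarrow> nat" where
  "cycle_count n j = card {p \<in> Sym n. num_cycles n p = j}"

end

(* Inversion sequences identify the middle order with the product of the chains {0..i-1} for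
   1 <= i <= n, so an interval is boolean iff its endpoints differ by at most 1 in each coordinate.
   A boolean interval of rank k is thus a top element w together with a choice of k among the nonzero
   entries of its inversion sequence. Finally, the number of zeros of a sequence and the number of
   cycles of a permutation have the same distribution: coordinate n + 1 has one zero value and n
   nonzero ones, while n + 1 is added to a permutation of size n either as a new cycle or in one of
   n places inside the existing cycles. *)
theory Submission
  imports Defs
begin

section \<open>Inversion sequences as coordinates on permutations\<close>

lemma middle_le_iff:
  "middle_le n v w \<longleftrightarrow> (\<forall>i\<in>{1..n}. inv_entry v i \<le> inv_entry w i)"
proof -
  have "middle_le n v w \<longleftrightarrow> (\<forall>i\<in>set [1..<Suc n]. inv_entry v i \<le> inv_entry w i)"
    unfolding middle_le_def inv_seq_def
    by (simp only: list_all2_map1 list_all2_map2 list_all2_same)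
  also have "set [1..<Suc n] = {1..n}" by auto
  finally show ?thesis .
qed

lemma middle_rank_eq: "middle_rank n w = (\<Sum>i\<in>{1..n}. inv_entry w i)"
proof -
  have "middle_rank n w = sum (inv_entry w) (set [1..<Suc n])"
    unfolding middle_rank_def inv_seq_def by (rule interv_sum_list_conv_sum_set_nat)
  also have "set [1..<Suc n] = {1..n}" by auto
  finally show ?thesis .
qed

lemma inv_entry_less: "1 \<le> i \<Longrightarrow> inv_entry w i < i"
proof -
  assume "1 \<le> i"
  have "inv_entry w i \<le> card {1..<i}"
    unfolding inv_entry_def by (rule card_mono) auto
  with \<open>1 \<le> i\<close> show ?thesis by simp
qed

lemma finite_Sym [simp]: "finite (Sym n)"
  unfolding Sym_def by (simp add: finite_permutations)

lemma card_less_permutes: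
  fixes p :: "nat \<Rightarrow> nat"
  assumes p: "p permutes {1..n}" and a: "a \<in> {1..n}"
  shows "card {b\<in>{1..n}. p b < p a} = p a - 1"
proof -
  have pa: "p a \<le> n" using p a permutes_in_seg by blast
  have "p ` {b\<in>{1..n}. p b < p a} = {1..<p a}"
  proof (intro equalityI subsetI)
    fix y assume "y \<in> p ` {b\<in>{1..n}. p b < p a}"
    then show "y \<in> {1..<p a}" using permutes_in_seg[OF p] by auto
  next
    fix y assume y: "y \<in> {1..<p a}"
    then have "y \<in> p ` {1..n}" using pa by (subst permutes_image[OF p]) auto
    then show "y \<in> p ` {b\<in>{1..n}. p b < p a}" using y by auto
  qed
  moreover have "inj_on p {b\<in>{1..n}. p b < p a}"
    using permutes_inj_on[OF p] by blast
  ultimately show ?thesis by (metis card_image card_atLeastLessThan)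
qed

text \<open>Each value of a permutation of \<open>{1..n}\<close> is one more than the number of
  smaller values, so comparisons between values already determine it.\<close>

lemma permutes_eq_if_same_order:
  fixes p q :: "nat \<Rightarrow> nat"
  assumes p: "p permutes {1..n}" and q: "q permutes {1..n}"
    and ord: "\<And>a b. a \<in> {1..n} \<Longrightarrow> b \<in> {1..n} \<Longrightarrow> p a < p b \<longleftrightarrow> q a < q b"
  shows "p = q"
proof
  fix a show "p a = q a"
  proof (cases "a \<in> {1..n}")
    case True
    then have "{b\<in>{1..n}. p b < p a} = {b\<in>{1..n}. q b < q a}" using ord by blast
    then have "p a - 1 = q a - 1"
      using card_less_permutes[OF p True] card_less_permutes[OF q True] by simp
    moreover have "1 \<le> p a" "1 \<le> q a"
      using permutes_in_seg[OF p True] permutes_in_seg[OF q True] by auto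
    ultimately show ?thesis by linarith
  next
    case False
    then show ?thesis using permutes_not_in[OF p] permutes_not_in[OF q] by metis
  qed
qed

text \<open>The sets on both sides are up-closed for the same order on A, hence comparable.\<close>

lemma greater_sets_eq:
  fixes p q :: "'a \<Rightarrow> 'b::linorder"
  assumes "finite A" and "i \<notin> A" "inj_on p (insert i A)"
    and ord: "\<And>a b. a \<in> A \<Longrightarrow> b \<in> A \<Longrightarrow> p a < p b \<longleftrightarrow> q a < q b"
    and card: "card {j\<in>A. p i < p j} \<le> card {j\<in>A. q i < q j}"
  shows "{j\<in>A. p i < p j} \<subseteq> {j\<in>A. q i < q j}"
proof
  fix j assume j: "j \<in> {j\<in>A. p i < p j}"
  show "j \<in> {j\<in>A. q i < q j}"
  proof (rule ccontr)
    assume "j \<notin> {j\<in>A. q i < q j}"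
    then have qj: "q j \<le> q i" using j by auto
    \<comment> \<open>An element above \<open>i\<close> under \<open>q\<close> is then above
      \<open>j\<close> under \<open>q\<close>, hence above \<open>j\<close> under \<open>p\<close>,
      hence above \<open>i\<close> under \<open>p\<close>. Strictness excludes \<open>j\<close>
      itself.\<close>
    have "{j\<in>A. q i < q j} \<subseteq> {j\<in>A. p i < p j} - {j}"
      using j qj ord by (fastforce dest: order.strict_trans)
    then have "{j\<in>A. q i < q j} \<subset> {j\<in>A. p i < p j}" using j by auto
    then have "card {j\<in>A. q i < q j} < card {j\<in>A. p i < p j}"
      using \<open>finite A\<close> by (intro psubset_card_mono) auto
    then show False using card by simp
  qed
qed

text \<open>Induction on \<open>m\<close> rebuilds the word by inserting values in increasing order.
  Entry \<open>Suc m\<close> counts the values of \<open>{1..m}\<close> standing to the right of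
  \<open>Suc m\<close>. Once the relative order of \<open>{1..m}\<close> is known, this count fixes
  the place of \<open>Suc m\<close> among them.\<close>

lemma inv_entry_eq_imp_same_order:
  assumes v: "v permutes {1..n}" and w: "w permutes {1..n}"
    and eq: "\<And>i. i \<in> {1..n} \<Longrightarrow> inv_entry v i = inv_entry w i"
  shows "m \<le> n \<Longrightarrow> a \<in> {1..m} \<Longrightarrow> b \<in> {1..m} \<Longrightarrow> inv v a < inv v b \<longleftrightarrow> inv w a < inv w b"
proof (induction m arbitrary: a b)
  case 0
  then show ?case by simp
next
  case (Suc m)
  let ?p = "inv v" and ?q = "inv w" and ?A = "{1..m}"
  have p: "inj ?p" and q: "inj ?q"
    using permutes_inj[OF permutes_inv[OF v]] permutes_inj[OF permutes_inv[OF w]] .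
  have IH: "?p a < ?p b \<longleftrightarrow> ?q a < ?q b" if "a \<in> ?A" "b \<in> ?A" for a b
    using Suc.IH that Suc.prems(1) by simp
  have E: "inv_entry u (Suc m) = card {j\<in>?A. inv u (Suc m) < inv u j}" for u
    unfolding inv_entry_def by (rule arg_cong[where f = card]) auto
  have c: "card {j\<in>?A. ?p (Suc m) < ?p j} = card {j\<in>?A. ?q (Suc m) < ?q j}"
    using eq[of "Suc m"] Suc.prems(1) by (simp add: E)
  have sub: "{j\<in>?A. ?p (Suc m) < ?p j} = {j\<in>?A. ?q (Suc m) < ?q j}"
    by (intro equalityI greater_sets_eq inj_on_subset[OF p] inj_on_subset[OF q]) (simp_all only: IH c, simp_all)
  have key: "?p (Suc m) < ?p j \<longleftrightarrow> ?q (Suc m) < ?q j" if "j \<in> ?A" for j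
    using sub that by blast
  have ne: "?p (Suc m) \<noteq> ?p j" "?q (Suc m) \<noteq> ?q j" if "j \<in> ?A" for j
    using that by (auto simp: inj_eq[OF p] inj_eq[OF q])
  have key': "?p j < ?p (Suc m) \<longleftrightarrow> ?q j < ?q (Suc m)" if "j \<in> ?A" for j
    using key[OF that] ne[OF that] by (metis not_less_iff_gr_or_eq)
  consider "a \<in> ?A" "b \<in> ?A" | "a = Suc m" "b \<in> ?A" | "a \<in> ?A" "b = Suc m" | "a = Suc m" "b = Suc m"
    using Suc.prems(2,3) by (metis atLeastAtMost_iff le_Suc_eq)
  then show ?case by cases (use IH key key' in auto)
qed

text \<open>Restriction makes the sequence \<open>undefined\<close> outside \<open>{1..n}\<close>,
  as membership in \<open>PiE\<close> demands, so codes can be compared as functions.\<close>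

definition inv_code :: "nat \<Rightarrow> (nat \<Rightarrow> nat) \<Rightarrow> nat \<Rightarrow> nat" where
  "inv_code n w = restrict (inv_entry w) {1..n}"

lemma inj_on_inv_code: "inj_on (inv_code n) (Sym n)"
proof (rule inj_onI)
  fix v w assume "v \<in> Sym n" "w \<in> Sym n" and eq: "inv_code n v = inv_code n w"
  then have v: "v permutes {1..n}" and w: "w permutes {1..n}" by (auto simp: Sym_def)
  have "inv_entry v i = inv_entry w i" if "i \<in> {1..n}" for i
    using fun_cong[OF eq, of i] that by (simp add: inv_code_def)
  then have "inv v = inv w"
    using inv_entry_eq_imp_same_order[OF v w] 
    by (intro permutes_eq_if_same_order[of _ n] permutes_inv v w) blast
  then show "v = w" using permutes_inv_inv[OF v] permutes_inv_inv[OF w] by metis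
qed

text \<open>Surjectivity comes from counting: an injection from \<open>n!\<close> permutations into
  a product of chains of sizes 1 to \<open>n\<close>, which also has \<open>n!\<close>
  elements.\<close>

lemma bij_betw_inv_code: "bij_betw (inv_code n) (Sym n) (PiE {1..n} (\<lambda>i. {..<i}))"
proof -
  have fin: "finite (PiE {1..n} (\<lambda>i. {..<i}))" by (intro finite_PiE) auto
  have "inv_code n ` Sym n \<subseteq> PiE {1..n} (\<lambda>i. {..<i})"
    by (auto simp: inv_code_def inv_entry_less)
  moreover have "card (inv_code n ` Sym n) = card (PiE {1..n} (\<lambda>i. {..<i}))"
    using card_image[OF inj_on_inv_code] card_permutations[of "{1..n}" n]
    by (simp add: card_PiE fact_prod Sym_def)
  ultimately have "inv_code n ` Sym n = PiE {1..n} (\<lambda>i. {..<i})"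
    using fin by (intro card_subset_eq)
  then show ?thesis using inj_on_inv_code by (simp add: bij_betw_def)
qed

lemma inv_entry_inject:
  assumes "v \<in> Sym n" "w \<in> Sym n" "\<And>i. i \<in> {1..n} \<Longrightarrow> inv_entry v i = inv_entry w i"
  shows "v = w"
proof -
  have "inv_code n v = inv_code n w"
    using assms(3) unfolding inv_code_def by (rule restrict_ext)
  with inj_on_inv_code show ?thesis using assms(1,2) by (rule inj_onD)
qed

lemma inv_entry_surj:
  assumes "\<And>i. i \<in> {1..n} \<Longrightarrow> x i < i"
  shows "\<exists>u\<in>Sym n. \<forall>i\<in>{1..n}. inv_entry u i = x i"
proof -
  have "restrict x {1..n} \<in> inv_code n ` Sym n"
    using assms bij_betw_imp_surj_on[OF bij_betw_inv_code] by auto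
  then obtain u where u: "u \<in> Sym n" "restrict x {1..n} = inv_code n u" by blast
  have "inv_entry u i = x i" if "i \<in> {1..n}" for i
    using fun_cong[OF u(2), of i] that by (simp add: inv_code_def)
  with u(1) show ?thesis by blast
qed

section \<open>Boolean intervals in a product of chains\<close>

text \<open>A boolean algebra has no interval that is a three-element chain, since the middle element
  of such a chain would need a relative complement.\<close>

lemma boolean_poset_diamond:
  assumes "boolean_poset le P" "a \<in> P" "b \<in> P" "c \<in> P" "le a b" "le b c"
    and "a \<noteq> b" "b \<noteq> c"
  shows "\<exists>d\<in>P. le a d \<and> le d c \<and> d \<notin> {a, b, c}"
proof -
  obtain m :: nat and f where f: "bij_betw f P (Pow {1..m})"
    and le: "\<And>x y. x \<in> P \<Longrightarrow> y \<in> P \<Longrightarrow> le x y \<longleftrightarrow> f x \<subseteq> f y"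
    using assms(1) unfolding boolean_poset_def by blast
  have inj: "x \<in> P \<Longrightarrow> y \<in> P \<Longrightarrow> f x = f y \<longleftrightarrow> x = y" for x y
    using f by (auto simp: bij_betw_def inj_on_def)
  have ab: "f a \<subset> f b" and bc: "f b \<subset> f c" using assms le inj by auto
  have "f c \<subseteq> {1..m}" using f assms(4) by (auto simp: bij_betw_def)
  \<comment> \<open>This set is the complement of \<open>f b\<close> relative to the interval from
    \<open>f a\<close> to \<open>f c\<close>.\<close>
  then have "f a \<union> (f c - f b) \<in> f ` P"
    using ab bc bij_betw_imp_surj_on[OF f] by auto
  then obtain d where d: "d \<in> P" "f d = f a \<union> (f c - f b)" by (metis imageE)
  have "f d \<noteq> f a" "f d \<noteq> f b" "f d \<noteq> f c" using ab bc d(2) by auto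
  moreover have "f a \<subseteq> f d" "f d \<subseteq> f c" using ab bc d(2) by auto
  ultimately show ?thesis using d(1) le assms by blast
qed

text \<open>If coordinate \<open>i\<close> grew by 2 or more, raising it in \<open>v\<close> by 1
  and by 2 would give elements \<open>b\<close> and \<open>c\<close> of the interval, with nothing
  but \<open>v\<close>, \<open>b\<close>, \<open>c\<close> between \<open>v\<close> and
  \<open>c\<close>. This contradicts \<open>boolean_poset_diamond\<close>.\<close>

lemma boolean_interval_imp_diff_le_1:
  assumes v: "v \<in> Sym n" and w: "w \<in> Sym n" and vw: "middle_le n v w"
    and bool: "boolean_poset (middle_le n) (middle_interval n v w)" and i: "i \<in> {1..n}"
  shows "inv_entry w i \<le> inv_entry v i + 1"
proof (rule ccontr)
  assume "\<not> ?thesis"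
  then have gap: "inv_entry v i + 2 \<le> inv_entry w i" by simp
  have lt: "inv_entry w j < j" if "j \<in> {1..n}" for j
    using that by (intro inv_entry_less) simp
  have lt': "inv_entry v j < j" if "j \<in> {1..n}" for j
    using that by (intro inv_entry_less) simp
  \<comment> \<open>By \<open>gap\<close> the raised entry is at most \<open>inv_entry w i\<close>,
    hence below \<open>i\<close>, so some permutation has this inversion sequence.\<close>
  have ex: "\<exists>u\<in>Sym n. \<forall>j\<in>{1..n}. inv_entry u j = (if j = i then inv_entry v i + c else inv_entry v j)"
    if "c \<le> 2" for c
  proof -
    define x where "x j = (if j = i then inv_entry v i + c else inv_entry v j)" for j
    have "x j < j" if "j \<in> {1..n}" for j
      using lt[OF that] lt'[OF that] gap \<open>c \<le> 2\<close> by (auto simp: x_def)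
    then obtain u where "u \<in> Sym n" "\<And>j. j \<in> {1..n} \<Longrightarrow> inv_entry u j = x j"
      using inv_entry_surj[of n x] by blast
    then show ?thesis unfolding x_def by blast
  qed
  obtain b where b: "b \<in> Sym n"
    "\<And>j. j \<in> {1..n} \<Longrightarrow> inv_entry b j = (if j = i then inv_entry v i + 1 else inv_entry v j)"
    using ex[of 1] by auto
  obtain c where c: "c \<in> Sym n"
    "\<And>j. j \<in> {1..n} \<Longrightarrow> inv_entry c j = (if j = i then inv_entry v i + 2 else inv_entry v j)"
    using ex[of 2] by auto
  let ?P = "middle_interval n v w"
  have mem: "v \<in> ?P" "b \<in> ?P" "c \<in> ?P"
    using v b c gap vw by (auto simp: middle_interval_def middle_le_iff)
  have le: "middle_le n v b" "middle_le n b c" using b c by (auto simp: middle_le_iff)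
  have "v \<noteq> b" "b \<noteq> c" using b(2)[OF i] c(2)[OF i] by auto
  from boolean_poset_diamond[OF bool mem le this]
  obtain d where d: "d \<in> Sym n" "middle_le n v d" "middle_le n d c" "d \<notin> {v, b, c}"
    by (auto simp: middle_interval_def)
  \<comment> \<open>Off coordinate \<open>i\<close> the entries of \<open>v\<close> and
    \<open>c\<close> coincide, so \<open>d\<close> is determined by its entry at \<open>i\<close>,
    which has only three possible values.\<close>
  have off: "inv_entry d j = inv_entry v j" if "j \<in> {1..n}" "j \<noteq> i" for j
  proof (rule order.antisym)
    show "inv_entry v j \<le> inv_entry d j" using d(2) that(1) by (simp add: middle_le_iff)
    have "inv_entry d j \<le> inv_entry c j" using d(3) that(1) by (simp add: middle_le_iff)
    then show "inv_entry d j \<le> inv_entry v j" using c(2)[OF that(1)] that(2) by simp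
  qed
  have "inv_entry v i \<le> inv_entry d i" "inv_entry d i \<le> inv_entry c i"
    using d(2,3) i by (simp_all add: middle_le_iff)
  then consider "inv_entry d i = inv_entry v i" | "inv_entry d i = inv_entry v i + 1"
    | "inv_entry d i = inv_entry v i + 2"
    using c(2)[OF i] by fastforce
  then have "d = v \<or> d = b \<or> d = c"
  proof cases
    case 1
    then have "inv_entry d j = inv_entry v j" if "j \<in> {1..n}" for j
      using off[OF that] by (cases "j = i") auto
    then show ?thesis using inv_entry_inject[OF d(1) v] by blast
  next
    case 2
    then have "inv_entry d j = inv_entry b j" if "j \<in> {1..n}" for j
      using off[OF that] b(2)[OF that] by (cases "j = i") auto
    then show ?thesis using inv_entry_inject[OF d(1) b(1)] by blast
  next
    case 3
    then have "inv_entry d j = inv_entry c j" if "j \<in> {1..n}" for j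
      using off[OF that] c(2)[OF that] by (cases "j = i") auto
    then show ?thesis using inv_entry_inject[OF d(1) c(1)] by blast
  qed
  then show False using d(4) by blast
qed

text \<open>A numbering of \<open>S\<close> transports the isomorphism to the ground set
  \<open>{1..m}\<close> fixed in \<open>boolean_poset\<close>, so later proofs may use a set of
  coordinates directly.\<close>

lemma boolean_poset_Pow:
  assumes "finite S" "bij_betw f P (Pow S)"
    and "\<And>x y. x \<in> P \<Longrightarrow> y \<in> P \<Longrightarrow> le x y \<longleftrightarrow> f x \<subseteq> f y"
  shows "boolean_poset le P"
proof -
  obtain g where g: "bij_betw g S {1..card S}"
    using finite_same_card_bij[OF assms(1), of "{1..card S}"] by auto
  have "bij_betw ((`) g \<circ> f) P (Pow {1..card S})"
    using assms(2) bij_betw_Pow[OF g] by (rule bij_betw_trans)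
  moreover have "le x y \<longleftrightarrow> ((`) g \<circ> f) x \<subseteq> ((`) g \<circ> f) y" if "x \<in> P" "y \<in> P" for x y
  proof -
    have "f x \<subseteq> S" "f y \<subseteq> S" using assms(2) that by (auto simp: bij_betw_def)
    then have "g ` f x \<subseteq> g ` f y \<longleftrightarrow> f x \<subseteq> f y"
      using bij_betw_imp_inj_on[OF g] by (metis image_mono inj_on_image_mem_iff subsetD subsetI imageI)
    then show ?thesis using assms(3)[OF that] by simp
  qed
  ultimately show ?thesis unfolding boolean_poset_def by blast
qed

text \<open>An element \<open>u\<close> of the interval is encoded by the set of coordinates where
  it exceeds \<open>v\<close>. As each coordinate has at most two possible values, this set
  determines \<open>u\<close>, and inclusion of sets is the order.\<close>

lemma diff_le_1_imp_boolean_interval: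
  assumes v: "v \<in> Sym n" and w: "w \<in> Sym n" and vw: "middle_le n v w"
    and diff: "\<And>i. i \<in> {1..n} \<Longrightarrow> inv_entry w i \<le> inv_entry v i + 1"
  shows "boolean_poset (middle_le n) (middle_interval n v w)"
proof (rule boolean_poset_Pow)
  let ?P = "middle_interval n v w" and ?S = "{i\<in>{1..n}. inv_entry v i < inv_entry w i}"
  let ?f = "\<lambda>u. {i\<in>{1..n}. inv_entry v i < inv_entry u i}"
  show "finite ?S" by simp
  have val: "inv_entry u i = (if i \<in> ?f u then inv_entry v i + 1 else inv_entry v i)"
    if "u \<in> ?P" "i \<in> {1..n}" for u i
  proof -
    have "inv_entry v i \<le> inv_entry u i" "inv_entry u i \<le> inv_entry w i"
      using that by (auto simp: middle_interval_def middle_le_iff)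
    then show ?thesis using diff[OF that(2)] that(2) by auto
  qed
  show "middle_le n x y \<longleftrightarrow> ?f x \<subseteq> ?f y" if "x \<in> ?P" "y \<in> ?P" for x y
  proof
    show "middle_le n x y \<Longrightarrow> ?f x \<subseteq> ?f y" by (force simp: middle_le_iff)
    assume sub: "?f x \<subseteq> ?f y"
    show "middle_le n x y"
      unfolding middle_le_iff
    proof
      fix i assume i: "i \<in> {1..n}"
      show "inv_entry x i \<le> inv_entry y i"
        unfolding val[OF that(1) i] val[OF that(2) i] using sub by auto
    qed
  qed
  show "bij_betw ?f ?P (Pow ?S)"
  proof (rule bij_betw_imageI)
    show "inj_on ?f ?P"
    proof (rule inj_onI)
      fix x y assume x: "x \<in> ?P" and y: "y \<in> ?P" and eq: "?f x = ?f y"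
      have "inv_entry x i = inv_entry y i" if "i \<in> {1..n}" for i
        unfolding val[OF x that] val[OF y that] by (simp only: eq)
      then show "x = y" using x y by (intro inv_entry_inject) (auto simp: middle_interval_def)
    qed
    show "?f ` ?P = Pow ?S"
    proof (intro equalityI subsetI)
      fix T assume "T \<in> ?f ` ?P"
      then show "T \<in> Pow ?S"
        by (auto simp: middle_interval_def middle_le_iff intro: order.strict_trans2)
    next
      fix T assume T: "T \<in> Pow ?S"
      \<comment> \<open>The preimage of \<open>T\<close> follows \<open>w\<close> on
        \<open>T\<close> and \<open>v\<close> elsewhere. On \<open>T\<close> the entry of
        \<open>w\<close> is strictly larger, so exactly \<open>T\<close> is recovered.\<close>
      define x where "x i = (if i \<in> T then inv_entry w i else inv_entry v i)" for i
      have "x i < i" if "i \<in> {1..n}" for i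
        using that by (auto simp: x_def inv_entry_less)
      then obtain u where u: "u \<in> Sym n" "\<And>i. i \<in> {1..n} \<Longrightarrow> inv_entry u i = x i"
        using inv_entry_surj[of n x] by blast
      have "u \<in> ?P" using u vw by (auto simp: middle_interval_def middle_le_iff x_def)
      moreover have "?f u = T" using u T by (auto simp: x_def split: if_splits)
      ultimately show "T \<in> ?f ` ?P" by blast
    qed
  qed
qed

lemma boolean_interval_iff:
  assumes "v \<in> Sym n" "w \<in> Sym n" "middle_le n v w"
  shows "boolean_poset (middle_le n) (middle_interval n v w) \<longleftrightarrow>
    (\<forall>i\<in>{1..n}. inv_entry w i \<le> inv_entry v i + 1)"
proof
  assume "boolean_poset (middle_le n) (middle_interval n v w)"
  then show "\<forall>i\<in>{1..n}. inv_entry w i \<le> inv_entry v i + 1"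
    using boolean_interval_imp_diff_le_1[OF assms] by (intro ballI)
next
  assume "\<forall>i\<in>{1..n}. inv_entry w i \<le> inv_entry v i + 1"
  then show "boolean_poset (middle_le n) (middle_interval n v w)"
    by (intro diff_le_1_imp_boolean_interval assms) (rule bspec)
qed

section \<open>Counting boolean intervals by their top element\<close>

text \<open>The endpoints are the least and greatest elements of the interval, unique by
  antisymmetry. Hence counting intervals as sets amounts to counting pairs of endpoints.\<close>

lemma middle_interval_inject:
  assumes "v \<in> Sym n" "w \<in> Sym n" "middle_le n v w" "v' \<in> Sym n" "w' \<in> Sym n" "middle_le n v' w'"
    and eq: "middle_interval n v w = middle_interval n v' w'"
  shows "v = v' \<and> w = w'"
proof -
  have refl: "middle_le n u u" for u by (simp add: middle_le_iff)
  have anti: "x = y" if "x \<in> Sym n" "y \<in> Sym n" "middle_le n x y" "middle_le n y x" for x y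
    using that by (intro inv_entry_inject) (auto simp: middle_le_iff intro: order.antisym)
  have "v \<in> middle_interval n v' w'" "w \<in> middle_interval n v' w'"
    unfolding eq[symmetric] using assms refl by (auto simp: middle_interval_def)
  moreover have "v' \<in> middle_interval n v w" "w' \<in> middle_interval n v w"
    unfolding eq using assms refl by (auto simp: middle_interval_def)
  ultimately show ?thesis using assms anti by (auto simp: middle_interval_def)
qed

lemma card_boolean_intervals:
  "card (boolean_intervals n k) =
     (\<Sum>w\<in>Sym n. card {i\<in>{1..n}. inv_entry w i \<noteq> 0} choose k)"
proof -
  define Q where "Q = {(v, w). v \<in> Sym n \<and> w \<in> Sym n \<and> middle_le n v w \<and>
    (\<forall>i\<in>{1..n}. inv_entry w i \<le> inv_entry v i + 1) \<and> middle_rank n w - middle_rank n v = k}"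
  define D where "D v w = {i\<in>{1..n}. inv_entry v i < inv_entry w i}" for v w
  define N where "N w = {i\<in>{1..n}. inv_entry w i \<noteq> 0}" for w
  have "boolean_intervals n k = {middle_interval n v w | v w. (v, w) \<in> Q}"
    unfolding boolean_intervals_def Q_def mem_Collect_eq case_prod_conv
    by (simp only: boolean_interval_iff cong: conj_cong)
  also have "\<dots> = (\<lambda>(v, w). middle_interval n v w) ` Q" by force
  finally have "boolean_intervals n k = (\<lambda>(v, w). middle_interval n v w) ` Q" .
  moreover have "inj_on (\<lambda>(v, w). middle_interval n v w) Q"
  proof (rule inj_onI, clarify)
    fix v w v' w' assume "(v, w) \<in> Q" "(v', w') \<in> Q" "middle_interval n v w = middle_interval n v' w'"
    then show "v = v' \<and> w = w'"
      unfolding Q_def by (intro middle_interval_inject) auto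
  qed
  ultimately have "card (boolean_intervals n k) = card Q" by (simp add: card_image)
  also have "\<dots> = card (SIGMA w:Sym n. {S. S \<subseteq> N w \<and> card S = k})"
  \<comment> \<open>The pair \<open>(v, w)\<close> is encoded by its top \<open>w\<close> and the
    set \<open>D v w\<close> of coordinates that drop by one on passing from \<open>w\<close> to
    \<open>v\<close>.\<close>
  proof (rule bij_betw_same_card[of "\<lambda>(v, w). (w, D v w)"], rule bij_betw_imageI)
    have rank: "middle_rank n w - middle_rank n v = card (D v w)"
      if "middle_le n v w" "\<forall>i\<in>{1..n}. inv_entry w i \<le> inv_entry v i + 1" for v w
    proof -
      have "inv_entry w i = inv_entry v i + (if i \<in> D v w then 1 else 0)" if "i \<in> {1..n}" for i
        using that \<open>middle_le n v w\<close> \<open>\<forall>i\<in>{1..n}. inv_entry w i \<le> inv_entry v i + 1\<close>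
        by (auto simp: middle_le_iff D_def intro: order.antisym)
      then have "middle_rank n w = (\<Sum>i\<in>{1..n}. inv_entry v i + (if i \<in> D v w then 1 else 0))"
        unfolding middle_rank_eq by (intro sum.cong) auto
      also have "\<dots> = middle_rank n v + (\<Sum>i\<in>{1..n}. if i \<in> D v w then 1 else 0)"
        unfolding middle_rank_eq by (rule sum.distrib)
      also have "(\<Sum>i\<in>{1..n}. if i \<in> D v w then 1 else 0) = card ({1..n} \<inter> D v w)"
        by (simp flip: sum.inter_restrict)
      also have "{1..n} \<inter> D v w = D v w" by (auto simp: D_def)
      finally show ?thesis by simp
    qed
    show "inj_on (\<lambda>(v, w). (w, D v w)) Q"
    proof (rule inj_onI, clarify, intro conjI)
      fix v w v' assume "(v, w) \<in> Q" "(v', w) \<in> Q" and eq: "D v w = D v' w"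
      then have a: "v \<in> Sym n" "v' \<in> Sym n"
        and b: "\<forall>i\<in>{1..n}. inv_entry v i \<le> inv_entry w i \<and> inv_entry w i \<le> inv_entry v i + 1"
        and c: "\<forall>i\<in>{1..n}. inv_entry v' i \<le> inv_entry w i \<and> inv_entry w i \<le> inv_entry v' i + 1"
        by (auto simp: Q_def middle_le_iff)
      have "inv_entry v i = inv_entry v' i" if "i \<in> {1..n}" for i
      proof -
        have "inv_entry v i < inv_entry w i \<longleftrightarrow> inv_entry v' i < inv_entry w i"
          using eq that by (auto simp: D_def)
        then show ?thesis using bspec[OF b that] bspec[OF c that] by linarith
      qed
      then show "v = v'" by (rule inv_entry_inject[OF a])
    qed auto
    show "(\<lambda>(v, w). (w, D v w)) ` Q = (SIGMA w:Sym n. {S. S \<subseteq> N w \<and> card S = k})"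
    proof (intro equalityI subsetI)
      fix z assume "z \<in> (\<lambda>(v, w). (w, D v w)) ` Q"
      then obtain v w where z: "z = (w, D v w)" and vw: "(v, w) \<in> Q" by auto
      then have "card (D v w) = k" using rank by (auto simp: Q_def)
      moreover have "D v w \<subseteq> N w" by (auto simp: D_def N_def)
      ultimately show "z \<in> (SIGMA w:Sym n. {S. S \<subseteq> N w \<and> card S = k})"
        using z vw by (auto simp: Q_def)
    next
      fix z assume "z \<in> (SIGMA w:Sym n. {S. S \<subseteq> N w \<and> card S = k})"
      then obtain w S where z: "z = (w, S)" and w: "w \<in> Sym n" and S: "S \<subseteq> N w" "card S = k" by auto
      \<comment> \<open>The truncated subtraction is a genuine decrement, since \<open>S\<close>
        lies in the set \<open>N w\<close> of nonzero entries.\<close>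
      define x where "x i = (if i \<in> S then inv_entry w i - 1 else inv_entry w i)" for i
      have "x i < i" if "i \<in> {1..n}" for i
        using that inv_entry_less[of i w] by (auto simp: x_def)
      then obtain v where v: "v \<in> Sym n" "\<And>i. i \<in> {1..n} \<Longrightarrow> inv_entry v i = x i"
        using inv_entry_surj[of n x] by blast
      have D: "D v w = S" using v S by (auto simp: D_def N_def x_def split: if_splits)
      have vw: "middle_le n v w" "\<forall>i\<in>{1..n}. inv_entry w i \<le> inv_entry v i + 1"
        using v by (auto simp: middle_le_iff x_def)
      have "(v, w) \<in> Q" unfolding Q_def using v w vw rank[OF vw] D S by auto
      then show "z \<in> (\<lambda>(v, w). (w, D v w)) ` Q" using z D by force
    qed
  qed
  also have "\<dots> = (\<Sum>w\<in>Sym n. card {S. S \<subseteq> N w \<and> card S = k})"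
    by (rule card_SigmaI) (auto simp: N_def)
  also have "\<dots> = (\<Sum>w\<in>Sym n. card (N w) choose k)"
    by (intro sum.cong refl n_subsets) (simp add: N_def)
  finally show ?thesis by (simp add: N_def)
qed

section \<open>Cycles after adding a new point\<close>

text \<open>Composition with the transposition splices \<open>a\<close> into the cycle of
  \<open>b\<close>, directly before \<open>b\<close>: the point that \<open>p\<close> sends to
  \<open>b\<close> now goes to \<open>a\<close>, and \<open>a\<close> goes to \<open>b\<close>. All
  other arrows of \<open>p\<close> are kept.\<close>

lemma orbit_insert_into_cycle:
  assumes p: "p permutes S" and "finite S" and a: "a \<notin> S" and b: "b \<in> S" and x: "x \<in> S"
  defines "q \<equiv> transpose a b \<circ> p"
  shows "orbit q x = (if b \<in> orbit p x then insert a (orbit p x) else orbit p x)"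
proof -
  have pa: "p a = a" using p a by (rule permutes_not_in)
  have ab: "a \<noteq> b" using a b by auto
  have qa: "q a = b" using pa by (simp add: q_def)
  have sub: "orbit p x \<subseteq> S" by (rule permutes_orbit_subset[OF p x])
  have qy: "q y = (if p y = b then a else p y)" if "y \<in> S" for y
    using that permutes_in_image[OF p, of y] a by (auto simp: q_def transpose_def)
  have q: "q permutes insert a S" unfolding q_def
    using p b by (intro permutes_compose[OF permutes_subset[OF p]] permutes_swap_id) auto
  have perm_p: "permutation p" and perm_q: "permutation q"
    using p q \<open>finite S\<close> permutation_permutes by blast+
  have xp: "x \<in> orbit p x" by (rule permutation_self_in_orbit[OF perm_p])
  have xq: "x \<in> orbit q x" by (rule permutation_self_in_orbit[OF perm_q])
  let ?O = "if b \<in> orbit p x then insert a (orbit p x) else orbit p x"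
  have closed: "q y \<in> ?O" if "y \<in> ?O" for y
  proof (cases "y = a")
    case True
    then show ?thesis using that qa sub a by (auto split: if_splits)
  next
    case False
    then have y: "y \<in> orbit p x" using that by (auto split: if_splits)
    then have "p y \<in> orbit p x" by (rule orbit.step)
    moreover have "q y = (if p y = b then a else p y)" using y sub by (intro qy) auto
    ultimately show ?thesis by auto
  qed
  \<comment> \<open>One step of \<open>p\<close> is either one step of \<open>q\<close> or, when the
    detour through \<open>a\<close> is taken, two.\<close>
  have pull: "p y \<in> orbit q x" if "y \<in> S" "y \<in> orbit q x" for y
  proof -
    have "q y \<in> orbit q x" "q (q y) \<in> orbit q x" using that(2) by (blast intro: orbit.step)+
    then show ?thesis using qy[OF that(1)] qa by (auto split: if_splits)
  qed
  have "orbit q x \<subseteq> ?O"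
  proof
    fix y assume "y \<in> orbit q x"
    then show "y \<in> ?O"
    proof induction
      case base
      show ?case using closed xp by simp
    next
      case (step y)
      then show ?case using closed by blast
    qed
  qed
  moreover have le: "orbit p x \<subseteq> orbit q x"
  proof
    fix y assume "y \<in> orbit p x"
    then show "y \<in> orbit q x"
    proof induction
      case base
      show ?case using pull x xq .
    next
      case (step y)
      then show ?case using pull sub by blast
    qed
  qed
  moreover have "a \<in> orbit q x" if b_in: "b \<in> orbit p x"
  proof -
    obtain c where c: "c \<in> orbit p x" "p c = b"
      using b_in by (cases rule: orbit.cases) (use xp in auto)
    then have "q c = a" using qy sub by auto
    then show ?thesis using c(1) le orbit.step by (metis subsetD)
  qed
  ultimately show ?thesis by auto
qed

text \<open>The orbit of \<open>a\<close> is that of \<open>b\<close>, so no orbit is added. The map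
  \<open>h\<close>, which puts \<open>a\<close> into the orbit of \<open>b\<close>, is injective on
  the old orbits because none of them contains \<open>a\<close>.\<close>

lemma card_orbits_insert_into_cycle:
  assumes p: "p permutes S" and "finite S" and a: "a \<notin> S" and b: "b \<in> S"
  shows "card (orbit (transpose a b \<circ> p) ` insert a S) = card (orbit p ` S)"
proof -
  define q where "q = transpose a b \<circ> p"
  define h where "h X = (if b \<in> X then insert a X else X)" for X
  have q: "q permutes insert a S" unfolding q_def
    using p b by (intro permutes_compose[OF permutes_subset[OF p]] permutes_swap_id) auto
  then have perm: "permutation q" using \<open>finite S\<close> permutation_permutes by blast
  have oq: "orbit q x = h (orbit p x)" if "x \<in> S" for x
    unfolding q_def h_def by (rule orbit_insert_into_cycle) (use assms that in auto)
  have "q a = b" using permutes_not_in[OF p a] by (simp add: q_def)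
  then have "orbit q a = orbit q b"
    using permutation_orbit_step[OF perm, of a] by simp
  then have "orbit q ` insert a S = orbit q ` S" using b by auto
  also have "\<dots> = h ` (orbit p ` S)" using oq by (simp add: image_image)
  also have "card \<dots> = card (orbit p ` S)"
  proof (intro card_image inj_onI)
    fix X Y assume "X \<in> orbit p ` S" "Y \<in> orbit p ` S" and eq: "h X = h Y"
    then have "a \<notin> X" "a \<notin> Y" using permutes_orbit_subset[OF p] a by blast+
    then show "X = Y" using eq by (auto simp: h_def split: if_splits)
  qed
  finally show ?thesis by (simp add: q_def)
qed

lemma card_orbits_insert_fixpoint:
  assumes p: "p permutes S" and "finite S" and a: "a \<notin> S"
  shows "card (orbit p ` insert a S) = Suc (card (orbit p ` S))"
proof -
  have "orbit p a = {a}" using permutes_not_in[OF p a] by (simp add: orbit_eq_singleton_iff)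
  moreover have "{a} \<notin> orbit p ` S" using permutes_orbit_subset[OF p] a by blast
  ultimately show ?thesis using \<open>finite S\<close> by simp
qed

section \<open>Equidistribution of zeros and cycles\<close>

text \<open>Permutations of size \<open>Suc n\<close> are the products
  \<open>transpose (Suc n) b \<circ> p\<close> with \<open>p\<close> of size \<open>n\<close>. For
  \<open>b = Suc n\<close> the transposition is the identity and a fixed point is added; the other
  \<open>n\<close> choices of \<open>b\<close> keep the number of cycles.\<close>

lemma sum_num_cycles_Suc:
  fixes F :: "nat \<Rightarrow> 'a::comm_semiring_1"
  shows "(\<Sum>p\<in>Sym (Suc n). F (num_cycles (Suc n) p)) =
    (\<Sum>p\<in>Sym n. F (Suc (num_cycles n p)) + of_nat n * F (num_cycles n p))"
proof -
  have S: "{1..Suc n} = insert (Suc n) {1..n}" by auto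
  have cyc: "num_cycles (Suc n) (transpose (Suc n) b \<circ> p) =
      (if b = Suc n then Suc (num_cycles n p) else num_cycles n p)"
    if "p permutes {1..n}" "b \<in> insert (Suc n) {1..n}" for b p
  proof (cases "b = Suc n")
    case True
    then show ?thesis
      unfolding num_cycles_def S using card_orbits_insert_fixpoint[OF that(1), of "Suc n"] by simp
  next
    case False
    then show ?thesis
      unfolding num_cycles_def S
      using card_orbits_insert_into_cycle[OF that(1), of "Suc n" b] that(2) by simp
  qed
  have "(\<Sum>p\<in>Sym (Suc n). F (num_cycles (Suc n) p)) =
     (\<Sum>b\<in>insert (Suc n) {1..n}. \<Sum>p\<in>Sym n. F (num_cycles (Suc n) (transpose (Suc n) b \<circ> p)))"
    unfolding Sym_def S by (rule sum_over_permutations_insert) auto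
  also have "\<dots> = (\<Sum>b\<in>insert (Suc n) {1..n}. \<Sum>p\<in>Sym n.
      F (if b = Suc n then Suc (num_cycles n p) else num_cycles n p))"
    by (intro sum.cong refl) (simp add: cyc Sym_def)
  also have "\<dots> = (\<Sum>p\<in>Sym n. F (Suc (num_cycles n p))) +
      (\<Sum>b\<in>{1..n}. \<Sum>p\<in>Sym n. F (num_cycles n p))"
    by (subst sum.insert) (auto intro!: arg_cong2[where f = "(+)"] sum.cong)
  finally show ?thesis by (simp add: sum.distrib sum_distrib_left)
qed

lemma sum_zeros_Suc:
  fixes F :: "nat \<Rightarrow> 'a::comm_semiring_1"
  defines "E \<equiv> \<lambda>n::nat. PiE {1..n} (\<lambda>i. {..<i})"
    and "Z \<equiv> \<lambda>n y. card {i\<in>{1..n}. y i = (0::nat)}"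
  shows "(\<Sum>y\<in>E (Suc n). F (Z (Suc n) y)) =
    (\<Sum>y\<in>E n. F (Suc (Z n y)) + of_nat n * F (Z n y))"
proof -
  have S: "{1..Suc n} = insert (Suc n) {1..n}" by auto
  have E: "E (Suc n) = (\<lambda>(c, g). g(Suc n := c)) ` ({..<Suc n} \<times> E n)"
    unfolding E_def S by (rule PiE_insert_eq)
  have inj: "inj_on (\<lambda>(c, g). g(Suc n := c)) ({..<Suc n} \<times> E n)"
    unfolding E_def by (rule inj_combinator) simp
  have Z: "Z (Suc n) (g(Suc n := c)) = (if c = 0 then Suc (Z n g) else Z n g)" for g c
  proof -
    have "{i\<in>{1..Suc n}. (g(Suc n := c)) i = 0} =
        (if c = 0 then insert (Suc n) {i\<in>{1..n}. g i = 0} else {i\<in>{1..n}. g i = 0})"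
      by auto
    then show ?thesis by (simp add: Z_def)
  qed
  have "(\<Sum>y\<in>E (Suc n). F (Z (Suc n) y)) =
      (\<Sum>(c, g)\<in>{..<Suc n} \<times> E n. F (if c = 0 then Suc (Z n g) else Z n g))"
    unfolding E sum.reindex[OF inj] by (intro sum.cong) (auto simp: Z)
  also have "\<dots> = (\<Sum>c<Suc n. \<Sum>g\<in>E n. F (if c = 0 then Suc (Z n g) else Z n g))"
    by (rule sum.cartesian_product[symmetric])
  also have "\<dots> = (\<Sum>g\<in>E n. F (Suc (Z n g))) + (\<Sum>c<n. \<Sum>g\<in>E n. F (Z n g))"
    \<comment> \<open>The shift splits off \<open>c = 0\<close>, leaving the \<open>n\<close>
      nonzero values of the last coordinate.\<close>
    by (subst sum.lessThan_Suc_shift) simp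
  finally show ?thesis by (simp add: sum.distrib sum_distrib_left)
qed

text \<open>Equality for every weight \<open>F\<close> expresses that the two statistics have the
  same distribution. Both sums obey the same recurrence, which changes the weight, so
  \<open>F\<close> must be arbitrary in the induction.\<close>

lemma sum_zeros_eq_sum_num_cycles:
  fixes F :: "nat \<Rightarrow> 'a::comm_semiring_1"
  shows "(\<Sum>y\<in>PiE {1..n} (\<lambda>i. {..<i}). F (card {i\<in>{1..n}. y i = 0})) =
    (\<Sum>p\<in>Sym n. F (num_cycles n p))"
proof (induction n arbitrary: F)
  case 0
  then show ?case by (simp add: Sym_def num_cycles_def)
next
  case (Suc n)
  show ?case
    unfolding sum_zeros_Suc sum_num_cycles_Suc
    by (rule Suc.IH[of "\<lambda>j. F (Suc j) + of_nat n * F j"])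
qed

theorem theorem3p8:
  fixes n k :: nat
  assumes "k < n"
  shows "card (boolean_intervals n k) = (\<Sum>i=0..n. (i choose k) * cycle_count n (n - i))"
proof -
  have cyc_le: "num_cycles n p \<le> n" for p
    unfolding num_cycles_def using card_image_le[of "{1..n}" "orbit p"] by simp
  have nonzeros: "card {i\<in>{1..n}. y i \<noteq> 0} = n - card {i\<in>{1..n}. y i = 0}" for y :: "nat \<Rightarrow> nat"
  proof -
    have "card {i\<in>{1..n}. y i \<noteq> 0} = card ({1..n} - {i\<in>{1..n}. y i = 0})"
      by (rule arg_cong[where f = card]) auto
    also have "\<dots> = card {1..n} - card {i\<in>{1..n}. y i = 0}"
      by (rule card_Diff_subset) auto
    finally show ?thesis by simp
  qed
  have "card (boolean_intervals n k) =
      (\<Sum>w\<in>Sym n. (n - card {i\<in>{1..n}. inv_code n w i = 0}) choose k)"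
    unfolding card_boolean_intervals nonzeros
    by (intro sum.cong refl arg_cong2[where f = "(choose)"] arg_cong2[where f = "(-)"]
        arg_cong[where f = card]) (auto simp: inv_code_def)
  also have "\<dots> = (\<Sum>y\<in>PiE {1..n} (\<lambda>i. {..<i}). (n - card {i\<in>{1..n}. y i = 0}) choose k)"
    by (rule sum.reindex_bij_betw[OF bij_betw_inv_code])
  also have "\<dots> = (\<Sum>p\<in>Sym n. (n - num_cycles n p) choose k)"
    by (rule sum_zeros_eq_sum_num_cycles[of "\<lambda>j. (n - j) choose k"])
  \<comment> \<open>Permutations are grouped by the value of \<open>n - num_cycles n p\<close>,
    which becomes the summation index.\<close>
  also have "\<dots> = (\<Sum>i\<in>{0..n}. \<Sum>p\<in>{p\<in>Sym n. n - num_cycles n p = i}. (n - num_cycles n p) choose k)"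
    by (rule sum.group[symmetric]) auto
  also have "\<dots> = (\<Sum>i=0..n. (i choose k) * cycle_count n (n - i))"
  proof (intro sum.cong refl)
    fix i assume i: "i \<in> {0..n}"
    \<comment> \<open>The bound \<open>cyc_le\<close> makes the truncated subtraction
      invertible.\<close>
    then have "{p\<in>Sym n. n - num_cycles n p = i} = {p\<in>Sym n. num_cycles n p = n - i}"
      using cyc_le by (auto simp: le_imp_diff_is_add)
    then show "(\<Sum>p\<in>{p\<in>Sym n. n - num_cycles n p = i}. (n - num_cycles n p) choose k) =
        (i choose k) * cycle_count n (n - i)"
      using i by (simp add: cycle_count_def)
  qed
  finally show ?thesis .
qed

end
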